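(* Let $q\ge 0$. If $u\to v$ is an edge of the persistence pairing graph $\mathcal G^{(q)}(\mathfrak F)$, then $i(v)<i(u)$. Consequently, $$b_v\le b_u<d_u<d_v.$$ In particular, $I_u\subseteq I_v$.
   Context: $K$ is a finite CW complex with fixed cell orientations and set of open cells $\mathcal K$; $\Bbbk$ is a field. $C_q$, $\partial_q$, $H_q$ denote cellular chains, boundary and homology with coefficients in $\Bbbk$. A filtration function $f:\mathcal K\to\mathbb R$ is fixed, i.e. $\tau\subseteq\overline\sigma$ implies $f(\tau)\le f(\sigma)$; its values are called filtration values. $K_t$ (resp. $K_{t^-}$) is the union of the cells $\sigma$ with $f(\sigma)\le t$ (resp. $f(\sigma)<t$), and $i_t:K_{t^-}\hookrightarrow K_t$ is the inclusion. The cells are totally ordered $\sigma_1\prec\dots\prec\sigma_N$ so that $f(\sigma_i)<f(\sigma_j)$ implies $i<j$, and $\sigma_i\subseteq\overline{\sigma_j}$, $\sigma_i\ne\sigma_j$ implies $i<j$. The sets $K_t$, $K_{t^-}$ and $\bigcup_{\ell\le p}\sigma_\ell$ are CW subcomplexes. The boundary matrix $D\in\Bbbk^{N\times N}$ has entries $D_{ij}=[\sigma_j:\sigma_i]$ (cellular incidence coefficients), so its $j$-th column is the coordinate vector of $\partial\sigma_j$. For a nonzero column $c$, $\operatorname{low}(c)=\max\{i\mid c_i\neq 0\}$. A matrix is reduced if no two of its nonzero columns have the same low. Fix a factorization $\mathcal R=(R,V)$, $R=DV$, with $R$ reduced and $V$ upper unitriangular and dimension preserving (column $V_i$ is supported only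 on cells of the same dimension as $\sigma_i$), and write $\mathfrak F=(K,f,\prec,\Bbbk,\mathcal R)$. Columns are identified with cellular chains. A cell $\sigma_i$ is positive if $R_i=0$; then $z_i:=V_i$ is its selected birth cycle. For positive $\sigma_i$, $\operatorname{pair}(i)=j$ if $\operatorname{low}(R_j)=i$ for some (necessarily unique) $j$ with $R_j\ne0$, and $\operatorname{pair}(i)=\infty$ otherwise. $\mathcal V^{(q)}$ is the set of labeled nonzero $q$-th persistence intervals: each $u\in\mathcal V^{(q)}$ corresponds to a positive $q$-cell with index $i(u)$, with $b_u=f(\sigma_{i(u)})$, $d_u=f(\sigma_{\operatorname{pair}(i(u))})$ if $\operatorname{pair}(i(u))<\infty$ and $d_u=\infty$ otherwise, and only those with $b_u<d_u$ are included. The interval is $I_u=[b_u,d_u)$, and $z_u:=z_{i(u)}$. Define $\mathcal D_t^{(q)}=\{u\in\mathcal V^{(q)}\mid b_u<t,\ d_u=t\}$ and $\mathcal S_t^{(q)}=\{v\in\mathcal V^{(q)}\mid b_v<t<d_v\}$. $[\cdot]_t$ and $[\cdot]_{t^-}$ denote classes in $H_q(K_t;\Bbbk)$ and $H_q(K_{t^-};\Bbbk)$. The classes $[z_v]_t$, $v\in\mathcal S_t^{(q)}$, form a basis of $\operatorname{im}(i_t)_*$; the transition coefficients $w_{uv}\in\Bbbk$ ($u\in\mathcal D_t^{(q)}$, $v\in\mathcal S_t^{(q)}$) are the unique scalars with $(i_t)_*[z_u]_{t^-}=\sum_{v\in\mathcal S_t^{(q)}}w_{uv}[z_v]_t$.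 The persistence pairing graph $\mathcal G^{(q)}(\mathfrak F)$ is the directed graph with vertex set $\mathcal V^{(q)}$ and edge set $\mathcal E^{(q)}=\{(u,v)\mid d_u<\infty,\ b_v<d_u<d_v,\ w_{uv}\ne0\}$; an edge $(u,v)$ is written $u\to v$. *)

theory Defs
  imports
    "HOL-Homology.Homology"
    "HOL-Algebra.Module"
    "HOL-Algebra.AbelCoset"
    "HOL-Library.Extended_Real"
    "Jordan_Normal_Form.Matrix"
    "Graph_Theory.Pair_Digraph"
begin

unbundle no vec_syntax
no_notation eq_closure_of ("closure'_of\<index>")

section \<open>Finite CW complexes\<close>

text \<open>
  As in \<^const>\<open>nsphere\<close>, points of n-space are functions \<open>nat \<Rightarrow> real\<close> vanishing from index
  \<open>n\<close> on. For \<open>n \<ge> 1\<close> the boundary of \<open>closed_disk n\<close> is \<open>nsphere (n - 1)\<close>;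
  \<open>closed_disk 0\<close> is a point with empty boundary.
\<close>

definition closed_disk :: "nat \<Rightarrow> (nat \<Rightarrow> real) set" where
  "closed_disk n = {x \<in> topspace (Euclidean_space n). (\<Sum>i<n. (x i)\<^sup>2) \<le> 1}"

definition open_disk :: "nat \<Rightarrow> (nat \<Rightarrow> real) set" where
  "open_disk n = {x \<in> topspace (Euclidean_space n). (\<Sum>i<n. (x i)\<^sup>2) < 1}"

text \<open>
  The record collects all the data: the space, its open cells, their dimensions and characteristic
  maps, the filtration function, the enumeration of the cells in the total order (starting at
  index 0), and the factorization \<open>R = D V\<close>. The orientation of a cell is the one transported from
  the standard disk by its characteristic map.
\<close>

record ('a, 'k) filtered_cw =
  cw_space :: "'a topology"
  cells :: "'a set set"
  cell_dim :: "'a set \<Rightarrow> nat"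
  char_map :: "'a set \<Rightarrow> (nat \<Rightarrow> real) \<Rightarrow> 'a"
  filt :: "'a set \<Rightarrow> real"
  cell_at :: "nat \<Rightarrow> 'a set"
  red_mat :: "'k mat"
  col_mat :: "'k mat"

text \<open>
  For finitely many cells in a Hausdorff space, closure finiteness and the weak topology follow
  from the conditions below.
\<close>

definition finite_cw_complex :: "('a, 'k) filtered_cw \<Rightarrow> bool" where
  "finite_cw_complex F \<longleftrightarrow>
     Hausdorff_space (cw_space F) \<and>
     finite (cells F) \<and>
     pairwise disjnt (cells F) \<and>
     \<Union>(cells F) = topspace (cw_space F) \<and>
     (\<forall>s\<in>cells F.
        continuous_map (subtopology (Euclidean_space (cell_dim F s)) (closed_disk (cell_dim F s)))
          (cw_space F) (char_map F s) \<and>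
        homeomorphic_map (subtopology (Euclidean_space (cell_dim F s)) (open_disk (cell_dim F s)))
          (subtopology (cw_space F) s) (char_map F s) \<and>
        char_map F s ` (closed_disk (cell_dim F s) - open_disk (cell_dim F s))
          \<subseteq> \<Union>{c \<in> cells F. cell_dim F c < cell_dim F s})"

text \<open>Subcomplexes are represented by their sets of open cells.\<close>

definition cw_subcomplex :: "('a, 'k) filtered_cw \<Rightarrow> 'a set set \<Rightarrow> bool" where
  "cw_subcomplex F L \<longleftrightarrow>
     L \<subseteq> cells F \<and> (\<forall>s\<in>L. cw_space F closure_of s \<subseteq> \<Union>L)"

text \<open>
  \<open>disk_collapse n\<close> maps the open n-disk homeomorphically onto the n-sphere minus the point with
  last coordinate -1, and the boundary of the disk to that point. Hence \<open>cell_pinch F c\<close> is the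
  quotient map that collapses, in the skeleton of dimension \<open>cell_dim F c\<close>, the complement of the
  open cell \<open>c\<close>, followed by the identification of the quotient with a sphere.
\<close>

definition disk_collapse :: "nat \<Rightarrow> (nat \<Rightarrow> real) \<Rightarrow> nat \<Rightarrow> real" where
  "disk_collapse n y =
     (let r = (\<Sum>i<n. (y i)\<^sup>2)
      in (\<lambda>i. if i < n then 2 * sqrt (1 - r) * y i else if i = n then 1 - 2 * r else 0))"

definition cell_pinch :: "('a, 'k) filtered_cw \<Rightarrow> 'a set \<Rightarrow> 'a \<Rightarrow> nat \<Rightarrow> real" where
  "cell_pinch F c x =
     (let n = cell_dim F c
      in if x \<in> c then disk_collapse n (inv_into (open_disk n) (char_map F c) x)
         else (\<lambda>i. if i = n then -1 else 0))"

text \<open>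
  The incidence coefficient is the degree of the attaching map of \<open>s\<close> followed by the pinch onto
  the cell \<open>c\<close> of dimension one less. For a 1-cell this gives endpoint minus starting point.
  The identification of spheres used by the pinch depends on the dimension only, so another choice
  of it would change each cellular boundary map at most by a global sign.
\<close>

definition incidence :: "('a, 'k) filtered_cw \<Rightarrow> 'a set \<Rightarrow> 'a set \<Rightarrow> int" where
  "incidence F s c =
     (if cell_dim F s = Suc (cell_dim F c)
      then Brouwer_degree2 (cell_dim F c) (cell_pinch F c \<circ> char_map F s)
      else 0)"


section \<open>Cellular homology with field coefficients\<close>

definition ncells :: "('a, 'k) filtered_cw \<Rightarrow> nat" where
  "ncells F = card (cells F)"

definition boundary_mat :: "('a, 'k::field) filtered_cw \<Rightarrow> 'k mat" where
  "boundary_mat F =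
     mat (ncells F) (ncells F) (\<lambda>(i, j). of_int (incidence F (cell_at F j) (cell_at F i)))"

text \<open>
  A chain is identified with its coordinate vector with respect to the ordered cells; the boundary
  operator is then multiplication by \<open>boundary_mat F\<close>.
\<close>

definition cell_chains :: "('a, 'k::field) filtered_cw \<Rightarrow> nat \<Rightarrow> 'a set set \<Rightarrow> 'k vec set" where
  "cell_chains F q L =
     {c \<in> carrier_vec (ncells F).
        \<forall>i<ncells F. c $ i \<noteq> 0 \<longrightarrow> cell_at F i \<in> L \<and> cell_dim F (cell_at F i) = q}"

definition cell_cycles :: "('a, 'k::field) filtered_cw \<Rightarrow> nat \<Rightarrow> 'a set set \<Rightarrow> 'k vec set" where
  "cell_cycles F q L = {c \<in> cell_chains F q L. boundary_mat F *\<^sub>v c = 0\<^sub>v (ncells F)}"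

definition cell_boundaries :: "('a, 'k::field) filtered_cw \<Rightarrow> nat \<Rightarrow> 'a set set \<Rightarrow> 'k vec set" where
  "cell_boundaries F q L = (\<lambda>b. boundary_mat F *\<^sub>v b) ` cell_chains F (Suc q) L"

abbreviation chain_module :: "('a, 'k::field) filtered_cw \<Rightarrow> ('k, 'k vec) module" where
  "chain_module F \<equiv> module_vec TYPE('k) (ncells F)"

definition hom_class ::
  "('a, 'k::field) filtered_cw \<Rightarrow> nat \<Rightarrow> 'a set set \<Rightarrow> 'k vec \<Rightarrow> 'k vec set" where
  "hom_class F q L z = cell_boundaries F q L +>\<^bsub>chain_module F\<^esub> z"

text \<open>
  The quotient space of cycles modulo boundaries, with cosets as elements. Scalar multiplication is
  defined through representatives (plainly multiplying a coset by 0 would not give the zero coset);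
  the multiplicative part of the record is not used.
\<close>

definition cell_homology ::
  "('a, 'k::field) filtered_cw \<Rightarrow> nat \<Rightarrow> 'a set set \<Rightarrow> ('k, 'k vec set) module" where
  "cell_homology F q L =
     \<lparr>carrier = hom_class F q L ` cell_cycles F q L,
      monoid.mult = undefined,
      one = undefined,
      zero = cell_boundaries F q L,
      add = (\<lambda>x y. x <+>\<^bsub>chain_module F\<^esub> y),
      smult = (\<lambda>a x. \<Union>z\<in>x. hom_class F q L (a \<cdot>\<^sub>v z))\<rparr>"

text \<open>
  The map induced by the inclusion of a subcomplex into the subcomplex \<open>L\<close>, sending the class
  of \<open>z\<close> to the class of \<open>z\<close> in \<open>L\<close>.
\<close>

definition hom_inclusion ::
  "('a, 'k::field) filtered_cw \<Rightarrow> nat \<Rightarrow> 'a set set \<Rightarrow> 'k vec set \<Rightarrow> 'k vec set" where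
  "hom_inclusion F q L x = (\<Union>z\<in>x. hom_class F q L z)"


section \<open>Filtration, reduction and pairing\<close>

definition sublevel :: "('a, 'k) filtered_cw \<Rightarrow> real \<Rightarrow> 'a set set" where
  "sublevel F t = {s \<in> cells F. filt F s \<le> t}"

definition strict_sublevel :: "('a, 'k) filtered_cw \<Rightarrow> real \<Rightarrow> 'a set set" where
  "strict_sublevel F t = {s \<in> cells F. filt F s < t}"

definition low :: "'k::zero vec \<Rightarrow> nat" where
  "low c = Max {i. i < dim_vec c \<and> c $ i \<noteq> 0}"

definition reduced :: "'k::zero mat \<Rightarrow> bool" where
  "reduced M \<longleftrightarrow>
     (\<forall>i<dim_col M. \<forall>j<dim_col M.
        col M i \<noteq> 0\<^sub>v (dim_row M) \<and> col M j \<noteq> 0\<^sub>v (dim_row M) \<and> low (col M i) = low (col M j)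
        \<longrightarrow> i = j)"

definition persistence_data :: "('a, 'k::field) filtered_cw \<Rightarrow> bool" where
  "persistence_data F \<longleftrightarrow>
     finite_cw_complex F \<and>
     (\<forall>c\<in>cells F. \<forall>s\<in>cells F. c \<subseteq> cw_space F closure_of s \<longrightarrow> filt F c \<le> filt F s) \<and>
     bij_betw (cell_at F) {..<ncells F} (cells F) \<and>
     (\<forall>i<ncells F. \<forall>j<ncells F. filt F (cell_at F i) < filt F (cell_at F j) \<longrightarrow> i < j) \<and>
     (\<forall>i<ncells F. \<forall>j<ncells F.
        cell_at F i \<subseteq> cw_space F closure_of cell_at F j \<and> cell_at F i \<noteq> cell_at F j \<longrightarrow> i < j) \<and>
     \<comment> \<open>not implied by the previous conditions, as a cell may meet the closure of another cell
        without being contained in it\<close>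
     (\<forall>t. cw_subcomplex F (sublevel F t) \<and> cw_subcomplex F (strict_sublevel F t)) \<and>
     (\<forall>p\<le>ncells F. cw_subcomplex F (cell_at F ` {..<p})) \<and>
     red_mat F \<in> carrier_mat (ncells F) (ncells F) \<and>
     col_mat F \<in> carrier_mat (ncells F) (ncells F) \<and>
     red_mat F = boundary_mat F * col_mat F \<and>
     reduced (red_mat F) \<and>
     upper_triangular (col_mat F) \<and>
     (\<forall>i<ncells F. col_mat F $$ (i, i) = 1) \<and>
     (\<forall>i<ncells F. \<forall>j<ncells F.
        col_mat F $$ (i, j) \<noteq> 0 \<longrightarrow> cell_dim F (cell_at F i) = cell_dim F (cell_at F j))"

definition positive_cell :: "('a, 'k::field) filtered_cw \<Rightarrow> nat \<Rightarrow> bool" where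
  "positive_cell F i \<longleftrightarrow> i < ncells F \<and> col (red_mat F) i = 0\<^sub>v (ncells F)"

definition birth_cycle :: "('a, 'k::field) filtered_cw \<Rightarrow> nat \<Rightarrow> 'k vec" where
  "birth_cycle F i = col (col_mat F) i"

definition is_pair :: "('a, 'k::field) filtered_cw \<Rightarrow> nat \<Rightarrow> nat \<Rightarrow> bool" where
  "is_pair F i j \<longleftrightarrow>
     j < ncells F \<and> col (red_mat F) j \<noteq> 0\<^sub>v (ncells F) \<and> low (col (red_mat F) j) = i"

text \<open>\<open>None\<close> stands for an unpaired cell, i.e. for the value infinity.\<close>

definition pair :: "('a, 'k::field) filtered_cw \<Rightarrow> nat \<Rightarrow> nat option" where
  "pair F i = (if \<exists>j. is_pair F i j then Some (THE j. is_pair F i j) else None)"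


section \<open>Persistence intervals and the pairing graph\<close>

definition birth :: "('a, 'k::field) filtered_cw \<Rightarrow> nat \<Rightarrow> real" where
  "birth F u = filt F (cell_at F u)"

definition death :: "('a, 'k::field) filtered_cw \<Rightarrow> nat \<Rightarrow> ereal" where
  "death F u = (case pair F u of Some j \<Rightarrow> ereal (filt F (cell_at F j)) | None \<Rightarrow> \<infinity>)"

text \<open>
  A labeled interval \<open>u\<close> is represented by the index \<open>i(u)\<close> of its positive cell, so that distinct
  labels with equal endpoints are kept apart.
\<close>

definition intervals :: "('a, 'k::field) filtered_cw \<Rightarrow> nat \<Rightarrow> nat set" where
  "intervals F q =
     {u. positive_cell F u \<and> cell_dim F (cell_at F u) = q \<and> ereal (birth F u) < death F u}"

definition interval_of :: "('a, 'k::field) filtered_cw \<Rightarrow> nat \<Rightarrow> real set" where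
  "interval_of F u = {t. birth F u \<le> t \<and> ereal t < death F u}"

definition dying :: "('a, 'k::field) filtered_cw \<Rightarrow> nat \<Rightarrow> real \<Rightarrow> nat set" where
  "dying F q t = {u \<in> intervals F q. birth F u < t \<and> death F u = ereal t}"

definition surviving :: "('a, 'k::field) filtered_cw \<Rightarrow> nat \<Rightarrow> real \<Rightarrow> nat set" where
  "surviving F q t = {v \<in> intervals F q. birth F v < t \<and> ereal t < death F v}"

definition transition_coeffs ::
  "('a, 'k::field) filtered_cw \<Rightarrow> nat \<Rightarrow> real \<Rightarrow> nat \<Rightarrow> (nat \<Rightarrow> 'k) \<Rightarrow> bool" where
  "transition_coeffs F q t u w \<longleftrightarrow>
     hom_inclusion F q (sublevel F t) (hom_class F q (strict_sublevel F t) (birth_cycle F u)) =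
     (\<Oplus>\<^bsub>cell_homology F q (sublevel F t)\<^esub> v \<in> surviving F q t.
        w v \<odot>\<^bsub>cell_homology F q (sublevel F t)\<^esub> hom_class F q (sublevel F t) (birth_cycle F v))"

text \<open>
  The coefficient family exists and is unique on \<open>surviving F q t\<close> because the classes occurring on
  the right-hand side of \<open>transition_coeffs\<close> form a basis of the image of the induced map; so the
  existential quantifier below says that the transition coefficient of \<open>(u, v)\<close> is nonzero.
\<close>

definition pairing_graph :: "('a, 'k::field) filtered_cw \<Rightarrow> nat \<Rightarrow> nat pair_pre_digraph" where
  "pairing_graph F q =
     \<lparr>pverts = intervals F q,
      parcs = {(u, v). u \<in> intervals F q \<and> v \<in> intervals F q \<and>
        (\<exists>t::real. death F u = ereal t \<and> birth F v < t \<and> ereal t < death F v \<and>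
           (\<exists>w. transition_coeffs F q t u w \<and> w v \<noteq> 0))}\<rparr>"

end

theory Submission
  imports Defs
begin

text \<open>
  An equation between classes in \<open>K\<^sub>t\<close> says that \<open>z\<^sub>u - \<Sum>\<^sub>v w\<^sub>v z\<^sub>v = \<partial>b\<close> for a chain \<open>b\<close> of
  \<open>K\<^sub>t\<close>. As \<open>V\<close> is unitriangular, \<open>b = V c\<close> with \<open>c\<close> supported in \<open>K\<^sub>t\<close>, so \<open>\<partial>b = R c\<close>; as \<open>R\<close>
  is reduced, no leading terms cancel and the low of \<open>\<partial>b\<close> is the low of a column \<open>R\<^sub>j\<close> whose cell
  lies in \<open>K\<^sub>t\<close>, i.e. the index of a class that is dead at time \<open>t\<close>. If some \<open>v > u\<close> had
  \<open>w\<^sub>v \<noteq> 0\<close>, the low of the left-hand side would be the largest such \<open>v\<close>, whose class survives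
  \<open>t\<close>. The argument does not use \<open>\<partial>\<partial> = 0\<close>.
\<close>

section \<open>Lows of matrix-vector products\<close>

text \<open>\<open>low\<close> is the \<open>Max\<close> of the support, which is empty for the zero
  vector; hence the hypothesis that \<open>c\<close> is nonzero.\<close>

lemma low_props:
  assumes "c \<in> carrier_vec n" "c \<noteq> 0\<^sub>v n"
  shows "low c < n" and "c $ low c \<noteq> 0" and "\<And>i. i < n \<Longrightarrow> c $ i \<noteq> 0 \<Longrightarrow> i \<le> low c"
proof -
  let ?S = "{i. i < dim_vec c \<and> c $ i \<noteq> 0}"
  have fin: "finite ?S" by simp
  have "?S \<noteq> {}"
  proof
    assume "?S = {}"
    then have "c = 0\<^sub>v n" using assms(1) by (intro eq_vecI) auto
    then show False using assms(2) by simp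
  qed
  then have "low c \<in> ?S" unfolding low_def by (rule Max_in[OF fin])
  then show "low c < n" "c $ low c \<noteq> 0" using assms(1) by auto
  show "i \<le> low c" if "i < n" "c $ i \<noteq> 0" for i
    unfolding low_def by (rule Max_ge[OF fin]) (use that assms(1) in auto)
qed

lemma low_eqI:
  assumes "c \<in> carrier_vec n" "i < n" "c $ i \<noteq> 0" "\<And>k. k < n \<Longrightarrow> i < k \<Longrightarrow> c $ k = 0"
  shows "low c = i"
  unfolding low_def using assms by (intro Max_eqI) (auto intro: leI)

lemma col_carrier: "M \<in> carrier_mat n m \<Longrightarrow> col M j \<in> carrier_vec n"
  by (intro carrier_vecI) simp

lemma mult_mat_vec_index:
  assumes "M \<in> carrier_mat n m" "a \<in> carrier_vec m" "i < n"
  shows "(M *\<^sub>v a) $ i = (\<Sum>j<m. M $$ (i, j) * a $ j)"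
  using assms by (auto simp: scalar_prod_def atLeast0LessThan intro!: sum.cong)

text \<open>The leading entry of \<open>a\<close> meets the diagonal entry 1 of \<open>V\<close> and
  is reproduced unchanged, while every later row of the product vanishes. Thus a combination of
  birth cycles has the low of its coefficient vector.\<close>

lemma low_unitriangular_mult:
  fixes V :: "'k::comm_ring_1 mat"
  assumes V: "V \<in> carrier_mat n n" "upper_triangular V" "\<forall>i<n. V $$ (i, i) = 1"
    and a: "a \<in> carrier_vec n" "a \<noteq> 0\<^sub>v n"
  shows "V *\<^sub>v a \<noteq> 0\<^sub>v n" and "low (V *\<^sub>v a) = low a"
proof -
  note la = low_props[OF a]
  \<comment> \<open>From row \<open>low a\<close> on, a column left of the diagonal gives a zero of
    \<open>V\<close>, and any other column lies beyond \<open>low a\<close> and gives a zero of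
    \<open>a\<close>. The only exception is the diagonal position at \<open>low a\<close>.\<close>
  have term0: "V $$ (i, j) * a $ j = 0" if "low a \<le> i" "i < n" "j < n" "j \<noteq> low a \<or> i \<noteq> low a" for i j
  proof (cases "j < i")
    case True
    then show ?thesis using upper_triangularD[OF V(2)] V(1) that(2) by auto
  next
    case False
    then have "low a < j" using that by auto
    then show ?thesis using la(3)[of j] that(3) by force
  qed
  have "(V *\<^sub>v a) $ low a = (\<Sum>j<n. if j = low a then a $ j else 0)"
    unfolding mult_mat_vec_index[OF V(1) a(1) la(1)]
    by (intro sum.cong refl) (use term0 la(1) V(3) in auto)
  then have 1: "(V *\<^sub>v a) $ low a \<noteq> 0" using la(1,2) by simp
  then show "V *\<^sub>v a \<noteq> 0\<^sub>v n" using la(1) by auto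
  show "low (V *\<^sub>v a) = low a"
  proof (rule low_eqI[OF _ la(1) 1])
    show "V *\<^sub>v a \<in> carrier_vec n" using V(1) a(1) by simp
    show "(V *\<^sub>v a) $ k = 0" if "k < n" "low a < k" for k
      unfolding mult_mat_vec_index[OF V(1) a(1) that(1)]
      by (intro sum.neutral) (use term0 that in auto)
  qed
qed

text \<open>Back substitution, with control of the support: column \<open>p\<close> of
  \<open>V\<close> lives on indices up to \<open>p\<close>, so for \<open>p\<close> in the downward
  closed set \<open>S\<close> it lives on \<open>S\<close>. Later \<open>S\<close> consists of the
  indices of the cells in a sublevel complex.\<close>

lemma unitriangular_solve:
  fixes V :: "'k::field mat"
  assumes V: "V \<in> carrier_mat n n" "upper_triangular V" "\<forall>i<n. V $$ (i, i) = 1"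
    and S: "\<forall>j\<in>S. \<forall>i<j. i \<in> S"
    and b: "b \<in> carrier_vec n" "\<forall>i<n. b $ i \<noteq> 0 \<longrightarrow> i \<in> S"
  obtains a where "a \<in> carrier_vec n" "V *\<^sub>v a = b" "\<And>i. i < n \<Longrightarrow> a $ i \<noteq> 0 \<Longrightarrow> i \<in> S"
proof -
  \<comment> \<open>The bound \<open>p\<close> on the support is the induction variable;
    \<open>p = n\<close> gives the claim.\<close>
  have "\<exists>a\<in>carrier_vec n. V *\<^sub>v a = b \<and> (\<forall>i<n. a $ i \<noteq> 0 \<longrightarrow> i \<in> S)"
    if "p \<le> n" "b \<in> carrier_vec n" "\<forall>i<n. b $ i \<noteq> 0 \<longrightarrow> i < p \<and> i \<in> S" for p b
    using that
  proof (induction p arbitrary: b)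
    case 0
    then have "b = 0\<^sub>v n" by (intro eq_vecI) auto
    then show ?case using V(1) by (intro bexI[of _ "0\<^sub>v n"]) auto
  next
    case (Suc p)
    show ?case
    proof (cases "b $ p = 0")
      case True
      then show ?thesis using Suc.IH[of b] Suc.prems by (metis Suc_leD less_Suc_eq)
    next
      case False
      then have p: "p < n" "p \<in> S" using Suc.prems by auto
      \<comment> \<open>Since the diagonal entry is 1, this clears entry \<open>p\<close>; all other
        changes occur at indices below \<open>p\<close>, which belong to \<open>S\<close> with
        \<open>p\<close>.\<close>
      define b' where "b' = b - b $ p \<cdot>\<^sub>v col V p"
      have colV: "col V p \<in> carrier_vec n" using col_carrier[OF V(1)] .
      have b': "b' \<in> carrier_vec n" using Suc.prems(2) colV unfolding b'_def by simp
      have "i < p \<and> i \<in> S" if i: "i < n" "b' $ i \<noteq> 0" for i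
      proof -
        have eq: "b' $ i = b $ i - b $ p * V $$ (i, p)"
          using i(1) p(1) V(1) Suc.prems(2) unfolding b'_def by simp
        have "i < p"
        proof (rule ccontr)
          assume "\<not> i < p"
          then consider "i = p" | "p < i" by linarith
          then show False
          proof cases
            case 1
            then show False using eq i V(3) by simp
          next
            case 2
            then have "V $$ (i, p) = 0" "b $ i = 0"
              using upper_triangularD[OF V(2)] V(1) i(1) Suc.prems(3) by auto
            then show False using eq i by simp
          qed
        qed
        then show ?thesis using S p by blast
      qed
      then obtain a where a: "a \<in> carrier_vec n" "V *\<^sub>v a = b'" "\<forall>i<n. a $ i \<noteq> 0 \<longrightarrow> i \<in> S"
        using Suc.IH[of b'] b' p(1) by auto
      let ?e = "b $ p \<cdot>\<^sub>v unit_vec n p"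
      have "V *\<^sub>v (a + ?e) = V *\<^sub>v a + b $ p \<cdot>\<^sub>v (V *\<^sub>v unit_vec n p)"
        using V(1) a(1) by (simp add: mult_add_distrib_mat_vec[OF V(1)] mult_mat_vec[OF V(1)])
      also have "V *\<^sub>v unit_vec n p = col V p"
        using V(1) p(1) by (intro eq_vecI) auto
      also have "V *\<^sub>v a + b $ p \<cdot>\<^sub>v col V p = b"
        using Suc.prems(2) colV V(1) unfolding a(2) b'_def by (intro eq_vecI) auto
      finally have "V *\<^sub>v (a + ?e) = b" .
      moreover have "\<forall>i<n. (a + ?e) $ i \<noteq> 0 \<longrightarrow> i \<in> S"
        using a(1,3) p by (auto split: if_splits)
      ultimately show ?thesis using a(1) by (intro bexI[of _ "a + ?e"]) auto
    qed
  qed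
  from this[of n b] b that show ?thesis by auto
qed

text \<open>Distinct nonzero columns of a reduced matrix have distinct lows. Among the columns that
  contribute, exactly one has the largest low, so nothing can cancel its leading term; that term is
  nonzero because there are no zero divisors.\<close>

lemma low_reduced_mult:
  fixes R :: "'k::idom mat"
  assumes R: "R \<in> carrier_mat n m" "reduced R"
    and a: "a \<in> carrier_vec m" "R *\<^sub>v a \<noteq> 0\<^sub>v n"
  obtains j where "j < m" "a $ j \<noteq> 0" "col R j \<noteq> 0\<^sub>v n" "low (R *\<^sub>v a) = low (col R j)"
proof -
  \<comment> \<open>The columns that contribute to the product. Were there none, the product would
    be zero.\<close>
  define J where "J = {j. j < m \<and> a $ j \<noteq> 0 \<and> col R j \<noteq> 0\<^sub>v n}"
  have colR: "col R j \<in> carrier_vec n" for j using col_carrier[OF R(1)] .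
  have entry: "R $$ (i, j) = col R j $ i" if "i < n" "j < m" for i j
    using R(1) that by simp
  have off: "R $$ (i, j) * a $ j = 0" if "i < n" "j < m" "j \<notin> J" for i j
    using that unfolding J_def by (auto simp: entry)
  have finJ: "finite J" unfolding J_def by simp
  have "J \<noteq> {}"
  proof
    assume "J = {}"
    then have "R *\<^sub>v a = 0\<^sub>v n"
      using R(1) a(1) off
      by (intro eq_vecI) (auto simp: mult_mat_vec_index[OF R(1) a(1)] simp del: index_mult_mat_vec
          intro!: sum.neutral)
    then show False using a(2) by simp
  qed
  then have "Max ((\<lambda>j. low (col R j)) ` J) \<in> (\<lambda>j. low (col R j)) ` J"
    using finJ by (intro Max_in) auto
  then obtain j where j: "j \<in> J" and jmax: "Max ((\<lambda>j. low (col R j)) ` J) = low (col R j)"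
    by auto
  have maxlow: "low (col R k) \<le> low (col R j)" if "k \<in> J" for k
    using that finJ unfolding jmax[symmetric] by (intro Max_ge) auto
  have strict: "low (col R k) < low (col R j)" if k: "k \<in> J" "k \<noteq> j" for k
  proof -
    have "low (col R k) \<noteq> low (col R j)"
      using R j k unfolding reduced_def J_def by auto
    then show ?thesis using maxlow[OF k(1)] by simp
  qed
  have jJ: "j < m" "a $ j \<noteq> 0" "col R j \<noteq> 0\<^sub>v n" using j unfolding J_def by auto
  note lj = low_props[OF colR jJ(3)]
  have above: "R $$ (i, k) * a $ k = 0" if "i < n" "k < m" "low (col R k) < i" for i k
  proof (cases "k \<in> J")
    case True
    then have "col R k \<noteq> 0\<^sub>v n" unfolding J_def by simp
    from low_props(3)[OF colR this that(1)] that show ?thesis by (auto simp: entry)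
  qed (use off that in auto)
  \<comment> \<open>In this row the other columns in \<open>J\<close> vanish because their lows are
    strictly smaller; columns outside \<open>J\<close> contribute nothing anywhere.\<close>
  have "(R *\<^sub>v a) $ low (col R j)
      = (\<Sum>k<m. if k = j then R $$ (low (col R j), j) * a $ j else 0)"
    unfolding mult_mat_vec_index[OF R(1) a(1) lj(1)]
    using above strict off lj(1) by (intro sum.cong refl) (auto, metis mult_eq_0_iff)
  then have nz: "(R *\<^sub>v a) $ low (col R j) \<noteq> 0"
    using jJ lj by (simp add: entry)
  have "low (R *\<^sub>v a) = low (col R j)"
  proof (rule low_eqI[OF _ lj(1) nz])
    show "R *\<^sub>v a \<in> carrier_vec n" using R(1) a(1) by simp
    fix i assume i: "i < n" "low (col R j) < i"
    show "(R *\<^sub>v a) $ i = 0"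
      unfolding mult_mat_vec_index[OF R(1) a(1) i(1)]
    proof (intro sum.neutral ballI)
      fix k assume "k \<in> {..<m}"
      then show "R $$ (i, k) * a $ k = 0"
        using above[OF i(1)] off[OF i(1)] maxlow[of k] i(2) by (cases "k \<in> J") force+
    qed
  qed
  then show thesis using that jJ by blast
qed

section \<open>Homology classes\<close>

lemma boundary_mat_carrier [simp]: "boundary_mat F \<in> carrier_mat (ncells F) (ncells F)"
  unfolding boundary_mat_def by simp

section \<open>Linear structure of chains, cycles and boundaries\<close>

lemma cell_chains_carrier: "cell_chains F q L \<subseteq> carrier_vec (ncells F)"
  unfolding cell_chains_def by auto

lemma zero_cell_chains: "0\<^sub>v (ncells F) \<in> cell_chains F q L"
  unfolding cell_chains_def by auto

lemma add_cell_chains: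
  assumes x: "x \<in> cell_chains F q L" and y: "y \<in> cell_chains F q L"
  shows "x + y \<in> cell_chains F q L"
proof -
  have carrier: "x \<in> carrier_vec (ncells F)" "y \<in> carrier_vec (ncells F)"
    using x y cell_chains_carrier by blast+
  have "cell_at F i \<in> L \<and> cell_dim F (cell_at F i) = q"
    if i: "i < ncells F" "(x + y) $ i \<noteq> 0" for i
  proof -
    have "x $ i \<noteq> 0 \<or> y $ i \<noteq> 0" using i carrier by auto
    then show ?thesis using x y i(1) unfolding cell_chains_def by blast
  qed
  then show ?thesis using carrier unfolding cell_chains_def by simp
qed

lemma smult_cell_chains: "x \<in> cell_chains F q L \<Longrightarrow> a \<cdot>\<^sub>v x \<in> cell_chains F q L"
  unfolding cell_chains_def by auto

lemma zero_cell_cycles: "0\<^sub>v (ncells F) \<in> cell_cycles F q L"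
proof -
  have "boundary_mat F *\<^sub>v 0\<^sub>v (ncells F) = 0\<^sub>v (ncells F)"
    by (intro eq_vecI) (auto simp: boundary_mat_def)
  then show ?thesis using zero_cell_chains[of F q L] unfolding cell_cycles_def by simp
qed

lemma cell_cycles_carrier: "cell_cycles F q L \<subseteq> carrier_vec (ncells F)"
  using cell_chains_carrier[of F q L] unfolding cell_cycles_def by auto

lemma add_cell_cycles:
  assumes "x \<in> cell_cycles F q L" "y \<in> cell_cycles F q L"
  shows "x + y \<in> cell_cycles F q L"
proof -
  have "x \<in> carrier_vec (ncells F)" "y \<in> carrier_vec (ncells F)"
    using assms cell_cycles_carrier[of F q L] by auto
  then show ?thesis using assms unfolding cell_cycles_def
    by (auto simp: add_cell_chains mult_add_distrib_mat_vec[OF boundary_mat_carrier])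
qed

lemma smult_cell_cycles:
  assumes "x \<in> cell_cycles F q L"
  shows "a \<cdot>\<^sub>v x \<in> cell_cycles F q L"
proof -
  have "x \<in> carrier_vec (ncells F)" using assms cell_cycles_carrier[of F q L] by auto
  then show ?thesis using assms unfolding cell_cycles_def
    by (auto simp: smult_cell_chains mult_mat_vec[OF boundary_mat_carrier])
qed

lemma cell_boundaries_carrier: "cell_boundaries F q L \<subseteq> carrier_vec (ncells F)"
  using cell_chains_carrier[of F "Suc q" L] unfolding cell_boundaries_def
  by (auto intro: mult_mat_vec_carrier[OF boundary_mat_carrier])

lemma smult_cell_boundaries:
  assumes "x \<in> cell_boundaries F q L"
  shows "a \<cdot>\<^sub>v x \<in> cell_boundaries F q L"
proof -
  obtain b where b: "b \<in> cell_chains F (Suc q) L" "x = boundary_mat F *\<^sub>v b"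
    using assms unfolding cell_boundaries_def by auto
  then have "a \<cdot>\<^sub>v x = boundary_mat F *\<^sub>v (a \<cdot>\<^sub>v b)"
    using cell_chains_carrier[of F "Suc q" L]
    by (simp add: mult_mat_vec[OF boundary_mat_carrier] subsetD)
  then show ?thesis using smult_cell_chains[OF b(1)] unfolding cell_boundaries_def by blast
qed

lemma abelian_group_chain_module: "abelian_group (chain_module F)"
proof (rule abelian_groupI)
  fix x assume "x \<in> carrier (chain_module F)"
  then show "\<exists>y\<in>carrier (chain_module F). y \<oplus>\<^bsub>chain_module F\<^esub> x = \<zero>\<^bsub>chain_module F\<^esub>"
    by (intro bexI[of _ "- x"]) (auto simp: module_vec_simps)
qed (auto simp: module_vec_simps comm_add_vec)

lemma minus_chain_module:
  assumes "x \<in> carrier_vec (ncells F)"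
  shows "\<ominus>\<^bsub>chain_module F\<^esub> x = - x"
proof -
  interpret abelian_group "chain_module F" by (rule abelian_group_chain_module)
  show ?thesis
    by (rule minus_equality) (use assms in \<open>auto simp: module_vec_simps\<close>)
qed

text \<open>Makes the library's theory of cosets available for \<open>hom_class\<close>. Inverses
  come from closure under multiplication by the scalar -1.\<close>

lemma abelian_subgroup_cell_boundaries:
  "abelian_subgroup (cell_boundaries F q L) (chain_module F)"
proof (rule abelian_subgroupI3[OF additive_subgroupI abelian_group_chain_module])
  interpret abelian_group "chain_module F" by (rule abelian_group_chain_module)
  show "subgroup (cell_boundaries F q L) (add_monoid (chain_module F))"
  proof (rule add.subgroupI)
    show "cell_boundaries F q L \<subseteq> carrier (chain_module F)"
      using cell_boundaries_carrier by (simp add: module_vec_simps)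
    show "cell_boundaries F q L \<noteq> {}"
      using zero_cell_chains[of F "Suc q" L] unfolding cell_boundaries_def by blast
    show "\<ominus>\<^bsub>chain_module F\<^esub> a \<in> cell_boundaries F q L" if "a \<in> cell_boundaries F q L" for a
    proof -
      have "a \<in> carrier_vec (ncells F)" using that cell_boundaries_carrier[of F q L] by auto
      moreover from this have "- a = (- 1) \<cdot>\<^sub>v a" by (intro eq_vecI) auto
      ultimately show ?thesis
        using smult_cell_boundaries[OF that, of "-1"] by (simp add: minus_chain_module)
    qed
    show "a \<oplus>\<^bsub>chain_module F\<^esub> b \<in> cell_boundaries F q L"
      if ab: "a \<in> cell_boundaries F q L" "b \<in> cell_boundaries F q L" for a b
    proof -
      obtain c d where cd: "c \<in> cell_chains F (Suc q) L" "a = boundary_mat F *\<^sub>v c"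
        "d \<in> cell_chains F (Suc q) L" "b = boundary_mat F *\<^sub>v d"
        using ab unfolding cell_boundaries_def by auto
      then have "a + b = boundary_mat F *\<^sub>v (c + d)"
        using cell_chains_carrier[of F "Suc q" L]
        by (simp add: mult_add_distrib_mat_vec[OF boundary_mat_carrier] subsetD)
      then show ?thesis
        using add_cell_chains[OF cd(1,3)] unfolding cell_boundaries_def module_vec_simps by blast
    qed
  qed
qed

section \<open>Calculus of homology classes through representatives\<close>

lemma hom_class_iff:
  "y \<in> hom_class F q L z \<longleftrightarrow> (\<exists>b\<in>cell_boundaries F q L. y = b + z)"
  unfolding hom_class_def a_r_coset_def' module_vec_simps by auto

lemma hom_class_eqI:
  assumes "z \<in> carrier_vec (ncells F)" "y \<in> hom_class F q L z"
  shows "hom_class F q L y = hom_class F q L z"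
proof -
  interpret abelian_subgroup "cell_boundaries F q L" "chain_module F"
    by (rule abelian_subgroup_cell_boundaries)
  show ?thesis unfolding hom_class_def
    using a_repr_independence[OF _ _ a_subgroup] assms
    unfolding hom_class_def module_vec_simps by metis
qed

lemma hom_class_self:
  assumes "z \<in> carrier_vec (ncells F)"
  shows "z \<in> hom_class F q L z"
proof -
  interpret abelian_subgroup "cell_boundaries F q L" "chain_module F"
    by (rule abelian_subgroup_cell_boundaries)
  show ?thesis unfolding hom_class_def
    by (rule a_rcos_self) (use assms in \<open>simp add: module_vec_simps\<close>)
qed

lemma hom_class_zero: "hom_class F q L (0\<^sub>v (ncells F)) = cell_boundaries F q L"
proof -
  have "b + 0\<^sub>v (ncells F) = b" if "b \<in> cell_boundaries F q L" for b
    using that cell_boundaries_carrier by (intro right_zero_vec) blast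
  then show ?thesis by (auto simp: hom_class_iff)
qed

lemma hom_class_add:
  assumes "x \<in> carrier_vec (ncells F)" "y \<in> carrier_vec (ncells F)"
  shows "hom_class F q L x \<oplus>\<^bsub>cell_homology F q L\<^esub> hom_class F q L y = hom_class F q L (x + y)"
proof -
  interpret abelian_subgroup "cell_boundaries F q L" "chain_module F"
    by (rule abelian_subgroup_cell_boundaries)
  show ?thesis
    using a_rcos_sum assms unfolding hom_class_def cell_homology_def by (simp add: module_vec_simps)
qed

text \<open>Scalar multiplication is a union over all representatives. Two representatives differ by
  a boundary, and so do their multiples, so the union runs over a nonempty family of equal
  cosets.\<close>

lemma hom_class_smult:
  assumes "z \<in> carrier_vec (ncells F)"
  shows "a \<odot>\<^bsub>cell_homology F q L\<^esub> hom_class F q L z = hom_class F q L (a \<cdot>\<^sub>v z)"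
proof -
  have "hom_class F q L (a \<cdot>\<^sub>v x) = hom_class F q L (a \<cdot>\<^sub>v z)" if "x \<in> hom_class F q L z" for x
  proof (rule hom_class_eqI)
    obtain b where b: "b \<in> cell_boundaries F q L" "x = b + z" using \<open>x \<in> _\<close> hom_class_iff by blast
    then have "b \<in> carrier_vec (ncells F)" using cell_boundaries_carrier by blast
    then have "a \<cdot>\<^sub>v x = a \<cdot>\<^sub>v b + a \<cdot>\<^sub>v z" using assms b(2) by (simp add: smult_add_distrib_vec)
    then show "a \<cdot>\<^sub>v x \<in> hom_class F q L (a \<cdot>\<^sub>v z)"
      using smult_cell_boundaries[OF b(1)] hom_class_iff by blast
  qed (use assms in simp)
  then have "(\<Union>x\<in>hom_class F q L z. hom_class F q L (a \<cdot>\<^sub>v x)) = hom_class F q L (a \<cdot>\<^sub>v z)"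
    using hom_class_self[OF assms] by (intro SUP_eq_const) blast+
  then show ?thesis by (simp add: cell_homology_def)
qed

text \<open>Gives access to the rules for \<open>finsum\<close>. Zero is the class of the zero
  cycle, so each axiom reduces to the corresponding law for vectors.\<close>

lemma abelian_monoid_cell_homology: "abelian_monoid (cell_homology F q L)"
proof -
  note [simp] = hom_class_add
  have car: "carrier (cell_homology F q L) = hom_class F q L ` cell_cycles F q L"
    and zero: "\<zero>\<^bsub>cell_homology F q L\<^esub> = hom_class F q L (0\<^sub>v (ncells F))"
    by (simp_all add: cell_homology_def hom_class_zero)
  have c: "x \<in> cell_cycles F q L \<Longrightarrow> x \<in> carrier_vec (ncells F)" for x
    using cell_cycles_carrier by blast
  have comm: "hom_class F q L (x + y) = hom_class F q L (y + x)"
    if "x \<in> cell_cycles F q L" "y \<in> cell_cycles F q L" for x y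
    using comm_add_vec[OF c c] that by metis
  show ?thesis
    by (rule abelian_monoidI)
      (auto simp: car zero c zero_cell_cycles add_cell_cycles
        assoc_add_vec[of _ "ncells F"] dest: comm[THEN equalityD1, THEN subsetD])
qed

text \<open>Turns a linear combination of classes into the class of a single matrix-vector product,
  to which the results on lows apply. The cycle condition places the summands in the carrier, as
  \<open>finsum_insert\<close> requires.\<close>

lemma finsum_hom_class:
  fixes F :: "('a, 'k::field) filtered_cw"
  assumes M: "M \<in> carrier_mat (ncells F) (ncells F)"
    and A: "A \<subseteq> {..<ncells F}" "\<And>v. v \<in> A \<Longrightarrow> col M v \<in> cell_cycles F q L"
  shows "(\<Oplus>\<^bsub>cell_homology F q L\<^esub> v \<in> A.
      w v \<odot>\<^bsub>cell_homology F q L\<^esub> hom_class F q L (col M v)) =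
    hom_class F q L (M *\<^sub>v vec (ncells F) (\<lambda>i. if i \<in> A then w i else 0))"
proof -
  interpret abelian_monoid "cell_homology F q L" by (rule abelian_monoid_cell_homology)
  let ?n = "ncells F"
  let ?a = "\<lambda>A. vec ?n (\<lambda>i. if i \<in> A then w i else 0)"
  have colM: "col M v \<in> carrier_vec ?n" for v using col_carrier[OF M] .
  have inc: "w v \<odot>\<^bsub>cell_homology F q L\<^esub> hom_class F q L (col M v) \<in> carrier (cell_homology F q L)"
    if "col M v \<in> cell_cycles F q L" for v
    unfolding hom_class_smult[OF colM] using smult_cell_cycles[OF that]
    by (simp add: cell_homology_def)
  have "finite A" using A(1) finite_subset by blast
  then show ?thesis using A
  proof (induction A)
    case empty
    have "?a {} = 0\<^sub>v ?n" by auto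
    then have "M *\<^sub>v ?a {} = 0\<^sub>v ?n" using M by (intro eq_vecI) auto
    then show ?case by (simp only: finsum_empty hom_class_zero) (simp add: cell_homology_def)
  next
    case (insert x A)
    have x: "x < ?n" using insert.prems by auto
    have "?a (insert x A) = w x \<cdot>\<^sub>v unit_vec ?n x + ?a A"
      using insert.hyps x by (intro eq_vecI) (auto simp: index_unit_vec)
    then have "M *\<^sub>v ?a (insert x A) = w x \<cdot>\<^sub>v (M *\<^sub>v unit_vec ?n x) + M *\<^sub>v ?a A"
      by (simp add: mult_add_distrib_mat_vec[OF M] mult_mat_vec[OF M])
    also have "M *\<^sub>v unit_vec ?n x = col M x"
      using M x by (intro eq_vecI) auto
    finally have eq: "M *\<^sub>v ?a (insert x A) = w x \<cdot>\<^sub>v col M x + M *\<^sub>v ?a A" .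
    have "(\<Oplus>\<^bsub>cell_homology F q L\<^esub> v \<in> insert x A.
          w v \<odot>\<^bsub>cell_homology F q L\<^esub> hom_class F q L (col M v)) =
        w x \<odot>\<^bsub>cell_homology F q L\<^esub> hom_class F q L (col M x) \<oplus>\<^bsub>cell_homology F q L\<^esub>
        hom_class F q L (M *\<^sub>v ?a A)"
      using insert inc by (subst finsum_insert) auto
    also have "\<dots> = hom_class F q L (w x \<cdot>\<^sub>v col M x + M *\<^sub>v ?a A)"
      using M colM by (simp add: hom_class_smult hom_class_add)
    finally show ?case unfolding eq .
  qed
qed

text \<open>Boundaries in \<open>L\<close> are boundaries in \<open>L'\<close>, so all
  representatives of a class in \<open>L\<close> have the same class in \<open>L'\<close>.\<close>

lemma hom_inclusion_hom_class:
  assumes "L \<subseteq> L'" and z: "z \<in> carrier_vec (ncells F)"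
  shows "hom_inclusion F q L' (hom_class F q L z) = hom_class F q L' z"
proof -
  have "cell_chains F (Suc q) L \<subseteq> cell_chains F (Suc q) L'"
    using assms(1) unfolding cell_chains_def by auto
  then have "cell_boundaries F q L \<subseteq> cell_boundaries F q L'"
    unfolding cell_boundaries_def by auto
  then have "hom_class F q L z \<subseteq> hom_class F q L' z"
    using hom_class_iff by blast
  then have "hom_class F q L' x = hom_class F q L' z" if "x \<in> hom_class F q L z" for x
    using that hom_class_eqI[OF z] by blast
  then show ?thesis
    using hom_class_self[OF z, of q L] unfolding hom_inclusion_def by (intro SUP_eq_const) blast+
qed

section \<open>Birth cycles and lows of boundaries\<close>

lemma persistence_dataD:
  assumes "persistence_data F"
  shows "bij_betw (cell_at F) {..<ncells F} (cells F)"
    and "\<And>i j. i < ncells F \<Longrightarrow> j < ncells F \<Longrightarrow>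
      filt F (cell_at F i) < filt F (cell_at F j) \<Longrightarrow> i < j"
    and "red_mat F \<in> carrier_mat (ncells F) (ncells F)"
    and "col_mat F \<in> carrier_mat (ncells F) (ncells F)"
    and "red_mat F = boundary_mat F * col_mat F"
    and "reduced (red_mat F)"
    and "upper_triangular (col_mat F)"
    and "\<forall>i<ncells F. col_mat F $$ (i, i) = 1"
    and "\<And>i j. i < ncells F \<Longrightarrow> j < ncells F \<Longrightarrow> col_mat F $$ (i, j) \<noteq> 0 \<Longrightarrow>
      cell_dim F (cell_at F i) = cell_dim F (cell_at F j)"
  using assms unfolding persistence_data_def by blast+

lemma filt_cell_at_mono:
  assumes "persistence_data F" "i \<le> j" "j < ncells F"
  shows "filt F (cell_at F i) \<le> filt F (cell_at F j)"
proof (rule ccontr)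
  assume "\<not> ?thesis"
  then have "j < i" using persistence_dataD(2)[OF assms(1), of j i] assms(2,3) by simp
  then show False using assms(2) by simp
qed

text \<open>The boundary of column \<open>v\<close> of \<open>V\<close> is column \<open>v\<close>
  of \<open>R\<close>, which is zero for a positive cell. Triangularity confines the support to
  cells up to \<open>v\<close>, which are present by the time of birth.\<close>

lemma birth_cycle_cycle:
  assumes F: "persistence_data F" and v: "v \<in> intervals F q" "birth F v \<le> t"
  shows "birth_cycle F v \<in> cell_cycles F q (sublevel F t)"
proof -
  let ?n = "ncells F"
  let ?V = "col_mat F"
  have V: "?V \<in> carrier_mat ?n ?n" "upper_triangular ?V"
    using persistence_dataD[OF F] by blast+
  have vn: "v < ?n" "col (red_mat F) v = 0\<^sub>v ?n" "cell_dim F (cell_at F v) = q"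
    using v(1) unfolding intervals_def positive_cell_def by auto
  have "red_mat F = boundary_mat F * ?V" using persistence_dataD[OF F] by blast
  then have "boundary_mat F *\<^sub>v col ?V v = 0\<^sub>v ?n"
    using vn V(1) col_mult2[OF boundary_mat_carrier V(1) vn(1)] by simp
  moreover have "cell_at F i \<in> sublevel F t \<and> cell_dim F (cell_at F i) = q"
    if i: "i < ?n" "col ?V v $ i \<noteq> 0" for i
  proof -
    have nz: "?V $$ (i, v) \<noteq> 0" using i vn V(1) by simp
    then have "i \<le> v" using upper_triangularD[OF V(2), of v i] i(1) V(1) by (auto intro: leI)
    then have "filt F (cell_at F i) \<le> filt F (cell_at F v)"
      using filt_cell_at_mono[OF F] vn(1) by blast
    moreover have "cell_at F i \<in> cells F"
      using persistence_dataD(1)[OF F] i(1) by (auto dest: bij_betwE)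
    moreover have "cell_dim F (cell_at F i) = cell_dim F (cell_at F v)"
      using persistence_dataD(9)[OF F i(1) vn(1) nz] .
    ultimately show ?thesis
      using vn(3) v(2) unfolding birth_def sublevel_def by simp
  qed
  ultimately show ?thesis
    using col_carrier[OF V(1), of v] unfolding birth_cycle_def cell_cycles_def cell_chains_def
    by blast
qed

text \<open>Reducedness makes the partner unique, so the \<open>THE\<close> in \<open>pair\<close>
  evaluates to \<open>j\<close>.\<close>

lemma death_eq:
  assumes F: "persistence_data F"
    and j: "j < ncells F" "col (red_mat F) j \<noteq> 0\<^sub>v (ncells F)"
  shows "death F (low (col (red_mat F) j)) = ereal (filt F (cell_at F j))"
proof -
  have R: "red_mat F \<in> carrier_mat (ncells F) (ncells F)" "reduced (red_mat F)"
    using persistence_dataD[OF F] by blast+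
  have p: "is_pair F (low (col (red_mat F) j)) j" using j unfolding is_pair_def by simp
  have "k = j" if "is_pair F (low (col (red_mat F) j)) k" for k
    using that j R unfolding is_pair_def reduced_def by auto
  then have "(THE k. is_pair F (low (col (red_mat F) j)) k) = j" using p by blast
  then have "pair F (low (col (red_mat F) j)) = Some j" using p unfolding pair_def by auto
  then show ?thesis unfolding death_def by simp
qed

text \<open>The low of a boundary in the sublevel complex is the low of a column of \<open>R\<close>
  whose cell has already entered, and that cell is the partner causing the death.\<close>

lemma death_low_boundary:
  assumes F: "persistence_data F"
    and c: "c \<in> cell_boundaries F q (sublevel F t)" "c \<noteq> 0\<^sub>v (ncells F)"
  shows "death F (low c) \<le> ereal t"
proof -
  let ?n = "ncells F"
  let ?V = "col_mat F"
  let ?R = "red_mat F"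
  have V: "?V \<in> carrier_mat ?n ?n" "upper_triangular ?V" "\<forall>i<?n. ?V $$ (i, i) = 1"
    and R: "?R \<in> carrier_mat ?n ?n" "reduced ?R" "?R = boundary_mat F * ?V"
    using persistence_dataD[OF F] by blast+
  obtain b where b: "b \<in> cell_chains F (Suc q) (sublevel F t)" "c = boundary_mat F *\<^sub>v b"
    using c(1) unfolding cell_boundaries_def by auto
  \<comment> \<open>Downward closed because the order of the cells refines the filtration
    values.\<close>
  define S where "S = {i. i < ?n \<and> filt F (cell_at F i) \<le> t}"
  have down: "\<forall>j\<in>S. \<forall>i<j. i \<in> S"
    using order_trans[OF filt_cell_at_mono[OF F less_imp_le]] unfolding S_def by auto
  have bS: "b \<in> carrier_vec ?n" "\<forall>i<?n. b $ i \<noteq> 0 \<longrightarrow> i \<in> S"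
    using b(1) unfolding cell_chains_def sublevel_def S_def by auto
  obtain a where
    a: "a \<in> carrier_vec ?n" "?V *\<^sub>v a = b" "\<And>i. i < ?n \<Longrightarrow> a $ i \<noteq> 0 \<Longrightarrow> i \<in> S"
    using unitriangular_solve[OF V down bS] by blast
  have "c = ?R *\<^sub>v a"
    using a(1) V(1) unfolding b(2) R(3) a(2)[symmetric]
    by (simp add: assoc_mult_mat_vec[OF boundary_mat_carrier])
  then obtain j where j: "j < ?n" "a $ j \<noteq> 0" "col ?R j \<noteq> 0\<^sub>v ?n" "low c = low (col ?R j)"
    using low_reduced_mult[OF R(1,2) a(1)] c(2) by blast
  then have "filt F (cell_at F j) \<le> t" using a(3) unfolding S_def by blast
  then show ?thesis using death_eq[OF F j(1,3)] j(4) by simp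
qed

lemma transition_coeffs_less:
  assumes F: "persistence_data F"
    and u: "u \<in> intervals F q" "death F u = ereal t"
    and w: "transition_coeffs F q t u w"
    and v: "v \<in> surviving F q t" "w v \<noteq> 0"
  shows "v < u"
proof (rule ccontr)
  assume "\<not> v < u"
  let ?n = "ncells F"
  let ?V = "col_mat F"
  let ?L = "sublevel F t"
  let ?A = "surviving F q t"
  have V: "?V \<in> carrier_mat ?n ?n" "upper_triangular ?V" "\<forall>i<?n. ?V $$ (i, i) = 1"
    using persistence_dataD[OF F] by blast+
  have A: "?A \<subseteq> {..<?n}" unfolding surviving_def intervals_def positive_cell_def by auto
  have un: "u < ?n" "u \<notin> ?A"
    using u unfolding surviving_def intervals_def positive_cell_def by auto
  have cyc: "col ?V x \<in> cell_cycles F q ?L" if "x \<in> ?A" for x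
    using birth_cycle_cycle[OF F, of x q t] that unfolding surviving_def birth_cycle_def by auto
  \<comment> \<open>\<open>w\<close> is arbitrary outside the surviving indices, so it is cut off to
    zero there. Then \<open>a\<close> holds the coefficients of the difference of the two sides with
    respect to the columns of \<open>V\<close>.\<close>
  define b where "b = vec ?n (\<lambda>i. if i \<in> ?A then w i else 0)"
  define a where "a = unit_vec ?n u - b"
  have b_carrier: "b \<in> carrier_vec ?n" unfolding b_def by simp
  then have a: "a \<in> carrier_vec ?n" unfolding a_def by simp
  have z: "birth_cycle F u \<in> carrier_vec ?n" unfolding birth_cycle_def using col_carrier[OF V(1)] .
  have Vb: "?V *\<^sub>v b \<in> carrier_vec ?n" using V(1) b_carrier by simp
  have "strict_sublevel F t \<subseteq> ?L" unfolding strict_sublevel_def sublevel_def by auto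
  \<comment> \<open>The two sides of \<open>transition_coeffs\<close>, each rewritten as the class
    of one chain.\<close>
  then have "hom_class F q ?L (birth_cycle F u) = hom_class F q ?L (?V *\<^sub>v b)"
    using w finsum_hom_class[OF V(1) A cyc] hom_inclusion_hom_class[OF _ z]
    unfolding transition_coeffs_def b_def by (simp add: birth_cycle_def)
  then obtain c where c: "c \<in> cell_boundaries F q ?L" "birth_cycle F u = c + ?V *\<^sub>v b"
    using hom_class_self[OF z] hom_class_iff by blast
  have c_carrier: "c \<in> carrier_vec ?n" using c(1) cell_boundaries_carrier by blast
  have "?V *\<^sub>v unit_vec ?n u = birth_cycle F u"
    using V(1) un unfolding birth_cycle_def by (intro eq_vecI) auto
  then have "?V *\<^sub>v a = birth_cycle F u - ?V *\<^sub>v b"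
    unfolding a_def using mult_minus_distrib_mat_vec[OF V(1) _ b_carrier] by simp
  also have "\<dots> = c" unfolding c(2) using c_carrier V(1) by (intro eq_vecI) auto
  finally have Va: "?V *\<^sub>v a = c" .
  have "v \<noteq> u" using v(1) un(2) by metis
  then have vn: "v < ?n" "u < v" using v(1) A \<open>\<not> v < u\<close> by auto
  \<comment> \<open>As \<open>v\<close> differs from \<open>u\<close>, this entry is
    \<open>- w v\<close>.\<close>
  have av: "a $ v \<noteq> 0" using vn v un b_carrier unfolding a_def b_def by simp
  then have a0: "a \<noteq> 0\<^sub>v ?n" using vn by auto
  note la = low_props[OF a a0]
  have "u < low a" using la(3)[OF vn(1) av] vn(2) by simp
  \<comment> \<open>Beyond \<open>u\<close> the unit vector vanishes, so a nonzero entry of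
    \<open>a\<close> comes from \<open>b\<close> and sits at a surviving index.\<close>
  then have "low a \<in> ?A"
    using la(1,2) un unfolding a_def b_def by (auto split: if_splits)
  then have "ereal t < death F (low a)" unfolding surviving_def by simp
  \<comment> \<open>The same index is the low of the boundary \<open>c\<close>, hence dead by time
    \<open>t\<close>.\<close>
  moreover have "death F (low a) \<le> ereal t"
    using death_low_boundary[OF F c(1)] low_unitriangular_mult[OF V a a0] unfolding Va by simp
  ultimately show False by simp
qed

theorem proposition3p6:
  fixes F :: "('a, 'k::field) filtered_cw" and q u v :: nat
  assumes "persistence_data F"
    and "(u, v) \<in> parcs (pairing_graph F q)"
  shows "v < u \<and>
    birth F v \<le> birth F u \<and> ereal (birth F u) < death F u \<and> death F u < death F v \<and>
    interval_of F u \<subseteq> interval_of F v"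
proof -
  obtain t w where u: "u \<in> intervals F q" and v: "v \<in> intervals F q"
    and t: "death F u = ereal t" "birth F v < t" "ereal t < death F v"
    and w: "transition_coeffs F q t u w" "w v \<noteq> 0"
    using assms(2) unfolding pairing_graph_def by auto
  have "v \<in> surviving F q t" using v t unfolding surviving_def by simp
  then have less: "v < u" using transition_coeffs_less[OF assms(1) u t(1) w(1)] w(2) by blast
  have "u < ncells F" "v < ncells F" using u v unfolding intervals_def positive_cell_def by auto
  \<comment> \<open>Distinct cells may share a filtration value, so the strict order of indices
    yields only a weak inequality.\<close>
  then have birth: "birth F v \<le> birth F u"
    using filt_cell_at_mono[OF assms(1), of v u] less unfolding birth_def by simp
  have "ereal (birth F u) < death F u" using u unfolding intervals_def by simp
  moreover have death: "death F u < death F v" using t by simp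
  moreover have "interval_of F u \<subseteq> interval_of F v"
    using birth death unfolding interval_of_def by auto
  ultimately show ?thesis using less birth by blast
qed

end
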